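(* Let $K\subset\mathbb{R}^n$ be a polyhedral cone with normalized conic base $B_K=\{u^1,\ldots,u^p\}$ ($p\ge 1$), so that $K=\operatorname{cone}(B_K)$, and let $d:=-P_{\operatorname{aff}(B_K)}(0)$ be its circumcentric direction. For $w\in\mathbb{R}^n\setminus\{0\}$ set $\rho_K(w):=\sup\{t\ge 0: d+tw\in K^\circ\}\in[0,+\infty]$. Then $$\rho_K(w)=\begin{cases}+\infty, & \max_{1\le i\le p}\langle w,u^i\rangle\le 0,\\[1mm] \dfrac{\|d\|^2}{\max_{1\le i\le p}\langle w,u^i\rangle}, & \text{otherwise.}\end{cases}$$ The infimum of $\rho_K$ over the unit sphere equals $\|d\|^2$ and is attained exactly at the points $w\in B_K$.
   Context: $\langle\cdot,\cdot\rangle$ and $\|\cdot\|$ are the Euclidean inner product and norm on $\mathbb{R}^n$. The normalized conic base $B_K=\{u^1,\ldots,u^p\}$ of a polyhedral cone $K$ is the finite set of unit vectors along the extreme rays of $K$; $\operatorname{cone}(B_K)$ is the set of finite nonnegative linear combinations of elements of $B_K$. The polar cone is $K^\circ=\{w\in\mathbb{R}^n:\langle w,z\rangle\le 0\ \text{for all } z\in K\}$. $\operatorname{aff}(B_K)$ is the affine hull and $P_{\operatorname{aff}(B_K)}(0)$ is the orthogonal projection of the origin onto it (this is the circumcenter of $B_K$).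
   Formalization: That the infimum is attained only at points of B_K is asserted for d ≠ 0 only; when 0 lies in aff(B_K), so d = 0, other unit vectors w also attain it. The formula, the value of the infimum and attainment on B_K hold without this. *)

theory Defs
  imports "HOL-Analysis.Analysis"
begin

definition polyhedral_cone :: "'a::euclidean_space set \<Rightarrow> bool" where
  "polyhedral_cone K \<longleftrightarrow> polyhedron K \<and> cone K"

text \<open>An extreme ray of \<open>K\<close> is a closed half-line from the origin that is a face of \<open>K\<close>.
  The relation \<^term>\<open>(face_of)\<close> admits improper faces, so a cone that is itself a half-line
  is its own extreme ray.\<close>

definition extreme_ray :: "'a::euclidean_space set \<Rightarrow> 'a set \<Rightarrow> bool" where
  "extreme_ray K R \<longleftrightarrow> (\<exists>v. v \<noteq> 0 \<and> R = {t *\<^sub>R v | t. 0 \<le> t}) \<and> R face_of K"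

definition normalized_conic_base :: "'a::euclidean_space set \<Rightarrow> 'a set" where
  "normalized_conic_base K = {v. norm v = 1 \<and> (\<exists>R. extreme_ray K R \<and> v \<in> R)}"

definition cone_generated :: "'a::euclidean_space set \<Rightarrow> 'a set" where
  "cone_generated B = {\<Sum>v\<in>S. c v *\<^sub>R v | S c. finite S \<and> S \<subseteq> B \<and> (\<forall>v\<in>S. 0 \<le> c v)}"

definition polar_cone :: "'a::euclidean_space set \<Rightarrow> 'a set" where
  "polar_cone K = {w. \<forall>z\<in>K. inner w z \<le> 0}"

text \<open>This vector may be \<open>0\<close>: four extreme rays in three-dimensional space can have unit vectors
  whose affine hull is the whole space. In that case \<open>rho K w\<close> below is \<open>0\<close> at every \<open>w\<close> where it is
  finite, so its minimizers on the unit sphere are not confined to the conic base.\<close>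

definition circumcentric_direction :: "'a::euclidean_space set \<Rightarrow> 'a" where
  "circumcentric_direction K = - closest_point (affine hull (normalized_conic_base K)) 0"

definition rho :: "'a::euclidean_space set \<Rightarrow> 'a \<Rightarrow> ereal" where
  "rho K w = Sup (ereal ` {t. 0 \<le> t \<and> circumcentric_direction K + t *\<^sub>R w \<in> polar_cone K})"

end

theory Submission
  imports Defs
begin

text \<open>Since the origin is a vertex of \<open>K\<close>, some linear functional is positive on \<open>K - {0}\<close>; its
  level set in \<open>K\<close> is compact, its extreme points span the extreme rays of \<open>K\<close>, and the
  Krein--Milman theorem gives \<open>K = cone(B)\<close>. The projection \<open>-d\<close> of the origin onto \<open>aff(B)\<close> has
  the same inner product \<open>\<parallel>d\<parallel>\<^sup>2\<close> with every element of \<open>B\<close>, so \<open>d + t w \<in> K\<^sup>\<circ>\<close> means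
  \<open>t \<langle>w, u\<rangle> \<le> \<parallel>d\<parallel>\<^sup>2\<close> for every \<open>u\<close> in \<open>B\<close>. The claim about minimizers is the equality case of the
  Cauchy--Schwarz inequality.\<close>

section \<open>Generated cones and their polars\<close>

lemma convex_cone_cone_generated: "convex_cone (cone_generated B)"
  unfolding convex_cone_iff
proof (intro conjI ballI allI impI)
  show "0 \<in> cone_generated B"
    unfolding cone_generated_def by (rule CollectI, rule exI[of _ "{}"]) simp
next
  fix x y assume "x \<in> cone_generated B" "y \<in> cone_generated B"
  then obtain S c T e where x: "x = (\<Sum>v\<in>S. c v *\<^sub>R v)" "finite S" "S \<subseteq> B" "\<forall>v\<in>S. 0 \<le> c v"
    and y: "y = (\<Sum>v\<in>T. e v *\<^sub>R v)" "finite T" "T \<subseteq> B" "\<forall>v\<in>T. 0 \<le> e v"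
    unfolding cone_generated_def by auto
  \<comment> \<open>The two representations may use different supports. Extending the coefficients
    by zero puts both sums over \<open>S \<union> T\<close>, where they can be added
    termwise.\<close>
  define c' where "c' v = (if v \<in> S then c v else 0)" for v
  define e' where "e' v = (if v \<in> T then e v else 0)" for v
  have "x = (\<Sum>v\<in>S \<union> T. c' v *\<^sub>R v)"
    unfolding x(1) by (rule sum.mono_neutral_cong_left) (use x y in \<open>auto simp: c'_def\<close>)
  moreover have "y = (\<Sum>v\<in>S \<union> T. e' v *\<^sub>R v)"
    unfolding y(1) by (rule sum.mono_neutral_cong_left) (use x y in \<open>auto simp: e'_def\<close>)
  ultimately have "x + y = (\<Sum>v\<in>S \<union> T. (c' v + e' v) *\<^sub>R v)"
    by (simp add: scaleR_add_left sum.distrib)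
  moreover have "\<forall>v\<in>S \<union> T. 0 \<le> c' v + e' v"
    using x y by (auto simp: c'_def e'_def)
  ultimately show "x + y \<in> cone_generated B"
    unfolding cone_generated_def using x(2,3) y(2,3)
    by (intro CollectI exI[of _ "S \<union> T"] exI[of _ "\<lambda>v. c' v + e' v"]) auto
next
  fix x and r :: real assume "x \<in> cone_generated B" "0 \<le> r"
  then obtain S c where x: "x = (\<Sum>v\<in>S. c v *\<^sub>R v)" "finite S" "S \<subseteq> B" "\<forall>v\<in>S. 0 \<le> c v"
    unfolding cone_generated_def by auto
  then have "r *\<^sub>R x = (\<Sum>v\<in>S. (r * c v) *\<^sub>R v)"
    by (simp add: scaleR_sum_right)
  then show "r *\<^sub>R x \<in> cone_generated B"
    unfolding cone_generated_def using x \<open>0 \<le> r\<close>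
    by (intro CollectI exI[of _ S] exI[of _ "\<lambda>v. r * c v"]) auto
qed

lemma cone_generated_superset: "B \<subseteq> cone_generated B"
proof
  fix v assume "v \<in> B"
  then show "v \<in> cone_generated B"
    unfolding cone_generated_def
    by (intro CollectI exI[of _ "{v}"] exI[of _ "\<lambda>_. 1"]) auto
qed

lemma cone_generated_minimal:
  assumes "convex_cone C" "B \<subseteq> C"
  shows "cone_generated B \<subseteq> C"
proof
  fix x assume "x \<in> cone_generated B"
  then obtain S c where x: "x = (\<Sum>v\<in>S. c v *\<^sub>R v)" "finite S" "S \<subseteq> B" "\<forall>v\<in>S. 0 \<le> c v"
    unfolding cone_generated_def by auto
  from x(2-4) have "(\<Sum>v\<in>S. c v *\<^sub>R v) \<in> C"
  proof (induction S rule: finite_induct)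
    case empty
    show ?case using convex_cone_contains_0[OF assms(1)] by simp
  next
    case (insert v S)
    then show ?case
      using assms by (auto intro!: convex_cone_add convex_cone_scaleR)
  qed
  then show "x \<in> C" using x(1) by simp
qed

text \<open>For fixed \<open>z\<close> the half-space \<open>{x. z \<bullet> x \<le> 0}\<close> is a
  convex cone, so once it contains the generators it contains the whole cone. Polarity thus becomes
  one inequality per base vector.\<close>

lemma mem_polar_cone_cone_generated_iff:
  "z \<in> polar_cone (cone_generated B) \<longleftrightarrow> (\<forall>v\<in>B. z \<bullet> v \<le> 0)"
proof
  assume "z \<in> polar_cone (cone_generated B)"
  then show "\<forall>v\<in>B. z \<bullet> v \<le> 0"
    using cone_generated_superset unfolding polar_cone_def by blast
next
  assume "\<forall>v\<in>B. z \<bullet> v \<le> 0"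
  then have "cone_generated B \<subseteq> {x. z \<bullet> x \<le> 0}"
    by (intro cone_generated_minimal convex_cone_halfspace_le) auto
  then show "z \<in> polar_cone (cone_generated B)"
    unfolding polar_cone_def by auto
qed

section \<open>Pointed polyhedral cones and their extreme rays\<close>

lemma extreme_ray_imp_extreme_point_0:
  assumes "extreme_ray K R"
  shows "0 extreme_point_of K"
proof -
  obtain v where v: "v \<noteq> 0" "R = {t *\<^sub>R v | t. 0 \<le> t}" and face: "R face_of K"
    using assms unfolding extreme_ray_def by blast
  have "0 extreme_point_of R"
    unfolding extreme_point_of_def
  proof (intro conjI ballI notI)
    show "0 \<in> R" unfolding v(2) by (intro CollectI exI[of _ 0]) simp
  next
    fix x y assume "x \<in> R" "y \<in> R" and op: "0 \<in> open_segment x y"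
    then obtain s t where st: "x = s *\<^sub>R v" "y = t *\<^sub>R v" "0 \<le> s" "0 \<le> t"
      unfolding v(2) by blast
    obtain r where r: "x \<noteq> y" "0 < r" "r < 1" "0 = (1 - r) *\<^sub>R x + r *\<^sub>R y"
      using op by (auto simp: in_segment)
    have "((1 - r) * s + r * t) *\<^sub>R v = 0"
      using r(4) st by (simp add: scaleR_add_left)
    then have "(1 - r) * s + r * t = 0" using v(1) by simp
    moreover have "0 \<le> (1 - r) * s" "0 \<le> r * t" using r st by auto
    ultimately have "s = 0 \<and> t = 0" using r(2,3)
      by (metis add_nonneg_eq_0_iff diff_gt_0_iff_gt less_irrefl mult_eq_0_iff)
    then show False using st r(1) by simp
  qed
  \<comment> \<open>A face of a face is a face, so the vertex \<open>0\<close> of the ray is also a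
    vertex of \<open>K\<close>.\<close>
  then show ?thesis
    using face face_of_singleton face_of_trans by metis
qed

text \<open>Every face of a polyhedron is exposed, so the vertex \<open>0\<close> is cut out by
  equality in some valid linear inequality. Evaluating at \<open>0\<close> shows that its right-hand
  side vanishes, and the negated normal is the required functional.\<close>

lemma polyhedral_cone_pointed_functional:
  assumes K: "polyhedral_cone K" and ext: "0 extreme_point_of K"
  obtains a where "\<And>x. x \<in> K \<Longrightarrow> x \<noteq> 0 \<Longrightarrow> 0 < a \<bullet> x"
proof -
  have "{0} exposed_face_of K"
    using K ext exposed_face_of_polyhedron face_of_singleton unfolding polyhedral_cone_def by metis
  then obtain a b where ab: "K \<subseteq> {x. a \<bullet> x \<le> b}" "{0} = K \<inter> {x. a \<bullet> x = b}"
    unfolding exposed_face_of_def by blast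
  have "0 \<in> K \<inter> {x. a \<bullet> x = b}" unfolding ab(2)[symmetric] by simp
  then have "b = 0" by simp
  have "0 < - a \<bullet> x" if "x \<in> K" "x \<noteq> 0" for x
    using ab that \<open>b = 0\<close> by fastforce
  then show ?thesis using that[of "- a"] by blast
qed

text \<open>On the compact set of unit vectors of \<open>K\<close> the functional attains a positive
  minimum \<open>m\<close>. By homogeneity \<open>a \<bullet> x \<ge> m * norm x\<close> on
  \<open>K\<close>, which bounds the slice by \<open>1 / m\<close>.\<close>

lemma compact_slice_pointed_cone:
  fixes a :: "'a::euclidean_space"
  assumes "closed K" "convex_cone K" and pos: "\<And>x. x \<in> K \<Longrightarrow> x \<noteq> 0 \<Longrightarrow> 0 < a \<bullet> x"
  shows "compact (K \<inter> {x. a \<bullet> x = 1})"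
proof -
  have norm_mem: "x /\<^sub>R norm x \<in> K \<inter> sphere 0 1" if "x \<in> K" "a \<bullet> x = 1" for x
  proof -
    have "x \<noteq> 0" using that by auto
    then show ?thesis using that convex_cone_scaleR[OF assms(2), of "inverse (norm x)" x] by simp
  qed
  have "bounded (K \<inter> {x. a \<bullet> x = 1})"
  proof (cases "K \<inter> sphere 0 1 = {}")
    case True
    then have "K \<inter> {x. a \<bullet> x = 1} = {}" using norm_mem by blast
    then show ?thesis by simp
  next
    case False
    have "compact (K \<inter> sphere 0 1)" using assms(1) by (simp add: closed_Int_compact)
    moreover have "continuous_on (K \<inter> sphere 0 1) (\<lambda>x. a \<bullet> x)" by (intro continuous_intros)
    ultimately obtain y where y: "y \<in> K \<inter> sphere 0 1" "\<forall>x\<in>K \<inter> sphere 0 1. a \<bullet> y \<le> a \<bullet> x"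
      using continuous_attains_inf False by metis
    have "0 < a \<bullet> y" using y(1) by (intro pos) auto
    have "norm x \<le> 1 / (a \<bullet> y)" if "x \<in> K" "a \<bullet> x = 1" for x
    proof -
      have "0 < norm x" using that by auto
      have "a \<bullet> y \<le> a \<bullet> (x /\<^sub>R norm x)" using y(2) norm_mem[OF that] by blast
      also have "\<dots> = 1 / norm x" using that by (simp add: divide_inverse)
      finally show ?thesis using \<open>0 < a \<bullet> y\<close> \<open>0 < norm x\<close> by (simp add: field_simps)
    qed
    then show ?thesis unfolding bounded_iff by blast
  qed
  moreover have "closed (K \<inter> {x. a \<bullet> x = 1})"
    using assms(1) closed_hyperplane by blast
  ultimately show ?thesis by (simp add: compact_eq_bounded_closed)
qed

text \<open>If a point of the ray lies strictly between \<open>p\<close> and \<open>q\<close> in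
  \<open>K\<close>, rescaling \<open>p\<close> and \<open>q\<close> into the slice exhibits
  \<open>v\<close> as a proper convex combination of slice points. Extremality makes both equal to
  \<open>v\<close>, so \<open>p\<close> and \<open>q\<close> lie on the ray.\<close>

lemma extreme_ray_through_slice_extreme_point:
  fixes a :: "'a::euclidean_space"
  assumes K: "convex_cone K" and pos: "\<And>x. x \<in> K \<Longrightarrow> x \<noteq> 0 \<Longrightarrow> 0 < a \<bullet> x"
    and v: "v extreme_point_of (K \<inter> {x. a \<bullet> x = 1})"
  shows "extreme_ray K {t *\<^sub>R v | t. 0 \<le> t}"
proof -
  let ?R = "{t *\<^sub>R v | t. 0 \<le> t}"
  have vK: "v \<in> K" "a \<bullet> v = 1" using v by (auto simp: extreme_point_of_def)
  have scale: "c *\<^sub>R x \<in> K" if "x \<in> K" "0 \<le> c" for x c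
    using convex_cone_scaleR[OF K] that by blast
  have "convex ?R"
  proof -
    have "?R = (\<lambda>t. t *\<^sub>R v) ` {0..}" by auto
    then show ?thesis
      by (simp add: convex_linear_image linear_scaleR_left)
  qed
  have "p \<in> ?R \<and> q \<in> ?R" if pq: "p \<in> K" "q \<in> K" and x: "x \<in> ?R" "x \<in> open_segment p q" for p q x
  proof -
    obtain t r where t: "0 \<le> t" and r: "0 < r" "r < 1" and eq: "t *\<^sub>R v = (1 - r) *\<^sub>R p + r *\<^sub>R q"
      using x by (auto simp: in_segment)
    have "0 \<in> ?R" by (intro CollectI exI[of _ 0]) simp
    \<comment> \<open>The origin cannot be rescaled into the slice. If one endpoint is
      \<open>0\<close>, the other is directly a nonnegative multiple of \<open>v\<close>.\<close>
    consider "p = 0" | "q = 0" | "p \<noteq> 0" "q \<noteq> 0" by blast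
    then show ?thesis
    proof cases
      case 1
      have "(t / r) *\<^sub>R v = (t *\<^sub>R v) /\<^sub>R r" by (simp add: divide_inverse_commute)
      also have "\<dots> = q" unfolding eq using 1 r by simp
      finally have "q = (t / r) *\<^sub>R v" ..
      then show ?thesis using 1 \<open>0 \<in> ?R\<close> t r by (auto intro!: exI[of _ "t / r"])
    next
      case 2
      have "(t / (1 - r)) *\<^sub>R v = (t *\<^sub>R v) /\<^sub>R (1 - r)" by (simp add: divide_inverse_commute)
      also have "\<dots> = p" unfolding eq using 2 r by simp
      finally have "p = (t / (1 - r)) *\<^sub>R v" ..
      then show ?thesis using 2 \<open>0 \<in> ?R\<close> t r by (auto intro!: exI[of _ "t / (1 - r)"])
    next
      case 3
      define \<alpha> \<beta> where "\<alpha> = a \<bullet> p" and "\<beta> = a \<bullet> q"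
      have pos': "0 < \<alpha>" "0 < \<beta>" using 3 pq pos by (auto simp: \<alpha>_def \<beta>_def)
      have teq: "t = (1 - r) * \<alpha> + r * \<beta>"
        using arg_cong[OF eq, of "\<lambda>z. a \<bullet> z"] vK(2) by (simp add: inner_add_right \<alpha>_def \<beta>_def)
      then have "0 < t" using pos' r by (simp add: add_pos_pos)
      \<comment> \<open>Dividing the equation for \<open>t *\<^sub>R v\<close> by \<open>t\<close>
        gives \<open>p'\<close> and \<open>q'\<close> the weights
        \<open>(1 - r) * \<alpha> / t\<close> and \<open>r * \<beta> / t\<close>. They sum to 1 by
        \<open>teq\<close>, and the second is \<open>s\<close>.\<close>
      define p' q' s where "p' = p /\<^sub>R \<alpha>" and "q' = q /\<^sub>R \<beta>" and "s = r * \<beta> / t"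
      have mem: "p' \<in> K \<inter> {x. a \<bullet> x = 1}" "q' \<in> K \<inter> {x. a \<bullet> x = 1}"
        using pq pos' scale by (auto simp: p'_def q'_def \<alpha>_def \<beta>_def)
      have s1: "1 - s = (1 - r) * \<alpha> / t"
        using \<open>0 < t\<close> teq by (simp add: s_def field_simps)
      have s: "0 < s" "0 < 1 - s"
        unfolding s1 using pos' r \<open>0 < t\<close> by (auto simp: s_def)
      have "(1 - s) *\<^sub>R p' = ((1 - r) *\<^sub>R p) /\<^sub>R t" "s *\<^sub>R q' = (r *\<^sub>R q) /\<^sub>R t"
        unfolding s1 using pos' by (simp_all add: s_def p'_def q'_def divide_inverse mult.commute)
      then have "(1 - s) *\<^sub>R p' + s *\<^sub>R q' = ((1 - r) *\<^sub>R p + r *\<^sub>R q) /\<^sub>R t"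
        by (simp only: scaleR_add_right)
      also have "\<dots> = v" using \<open>0 < t\<close> by (simp flip: eq)
      finally have comb: "v = (1 - s) *\<^sub>R p' + s *\<^sub>R q'" ..
      have "p' = q'"
      proof (rule ccontr)
        assume "p' \<noteq> q'"
        then have "v \<in> open_segment p' q'" using comb s by (auto simp: in_segment)
        then show False using v mem unfolding extreme_point_of_def by blast
      qed
      then have "p' = v" "q' = v" using comb by (auto simp flip: scaleR_add_left)
      moreover have "p = \<alpha> *\<^sub>R p'" "q = \<beta> *\<^sub>R q'" using pos' by (auto simp: p'_def q'_def)
      ultimately have "p = \<alpha> *\<^sub>R v" "q = \<beta> *\<^sub>R v" by simp_all
      then show ?thesis using pos' by (auto intro: less_imp_le)
    qed
  qed
  then have "?R face_of K"
    unfolding face_of_def using \<open>convex ?R\<close> vK(1) scale by blast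
  moreover have "v \<noteq> 0" using vK(2) by auto
  ultimately show ?thesis unfolding extreme_ray_def by blast
qed

lemma normalized_conic_base_subset: "normalized_conic_base K \<subseteq> K"
  unfolding normalized_conic_base_def extreme_ray_def by (auto dest: face_of_imp_subset)

text \<open>Pointedness is essential: without it there are no extreme rays, and the empty base
  generates only \<open>{0}\<close>.\<close>

lemma pointed_polyhedral_cone_eq_cone_generated:
  assumes K: "polyhedral_cone K" and ext: "0 extreme_point_of K"
  shows "K = cone_generated (normalized_conic_base K)"
proof
  let ?G = "cone_generated (normalized_conic_base K)"
  have "closed K" "convex K" "cone K" "0 \<in> K"
    using K ext polyhedron_imp_closed polyhedron_imp_convex
    unfolding polyhedral_cone_def extreme_point_of_def by auto
  then have cc: "convex_cone K" by (meson convex_cone convex_cone_iff)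
  show "?G \<subseteq> K"
    by (rule cone_generated_minimal[OF cc normalized_conic_base_subset])
  obtain a where a: "\<And>x. x \<in> K \<Longrightarrow> x \<noteq> 0 \<Longrightarrow> 0 < a \<bullet> x"
    using polyhedral_cone_pointed_functional[OF K ext] by blast
  let ?S = "K \<inter> {x. a \<bullet> x = 1}"
  have G: "convex_cone ?G" by (rule convex_cone_cone_generated)
  have "{v. v extreme_point_of ?S} \<subseteq> ?G"
  proof clarify
    fix v assume v: "v extreme_point_of ?S"
    then have "v \<noteq> 0" by (auto simp: extreme_point_of_def)
    then have "v /\<^sub>R norm v \<in> normalized_conic_base K"
      unfolding normalized_conic_base_def
      using extreme_ray_through_slice_extreme_point[OF cc a v]
      by (auto intro!: exI[of _ "{t *\<^sub>R v | t. 0 \<le> t}"] exI[of _ "inverse (norm v)"])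
    \<comment> \<open>The slice normalizes by the functional, the base by the norm; this rescaling
      passes between the two.\<close>
    then have "norm v *\<^sub>R (v /\<^sub>R norm v) \<in> ?G"
      using convex_cone_scaleR[OF G] cone_generated_superset by (metis norm_ge_zero subsetD)
    then show "v \<in> ?G" using \<open>v \<noteq> 0\<close> by simp
  qed
  then have "convex hull {v. v extreme_point_of ?S} \<subseteq> ?G"
    using G by (intro hull_minimal) (auto simp: convex_cone_def)
  moreover have "?S = convex hull {v. v extreme_point_of ?S}"
    using compact_slice_pointed_cone[OF \<open>closed K\<close> cc a] \<open>convex K\<close>
    by (intro Krein_Milman_Minkowski) (auto intro: convex_Int convex_hyperplane)
  ultimately have SG: "?S \<subseteq> ?G" by simp
  show "K \<subseteq> ?G"
  proof
    fix x assume x: "x \<in> K"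
    show "x \<in> ?G"
    proof (cases "x = 0")
      case True
      then show ?thesis using convex_cone_contains_0[OF G] by simp
    next
      case False
      then have "0 < a \<bullet> x" using a x by blast
      then have "x /\<^sub>R (a \<bullet> x) \<in> ?S"
        using x convex_cone_scaleR[OF cc, of "inverse (a \<bullet> x)" x] by simp
      then have "(a \<bullet> x) *\<^sub>R (x /\<^sub>R (a \<bullet> x)) \<in> ?G"
        using SG convex_cone_scaleR[OF G] \<open>0 < a \<bullet> x\<close> by (meson less_imp_le subsetD)
      then show ?thesis using \<open>0 < a \<bullet> x\<close> by simp
    qed
  qed
qed

section \<open>The circumcentric direction and a one-variable supremum\<close>

lemma closest_point_affine_orthogonal:
  fixes S :: "'a::euclidean_space set"
  assumes "affine S" "y \<in> S"
  shows "(a - closest_point S a) \<bullet> (y - closest_point S a) = 0"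
proof -
  let ?x = "closest_point S a"
  have S: "convex S" "closed S" using assms(1) affine_imp_convex affine_closed by auto
  have x: "?x \<in> S" using closest_point_in_set S(2) assms(2) by blast
  \<comment> \<open>This is the reflection of \<open>y\<close> in \<open>?x\<close>. Applying the
    variational inequality of the projection to it as well as to \<open>y\<close> yields both signs,
    hence equality.\<close>
  have "(1 - 2) *\<^sub>R y + 2 *\<^sub>R ?x \<in> S"
    using assms x unfolding affine_alt by blast
  then have "(a - ?x) \<bullet> ((1 - 2) *\<^sub>R y + 2 *\<^sub>R ?x - ?x) \<le> 0"
    by (rule closest_point_dot[OF S])
  moreover have "(1 - 2) *\<^sub>R y + 2 *\<^sub>R ?x - ?x = - (y - ?x)" by (simp add: scaleR_2)
  ultimately have "(a - ?x) \<bullet> - (y - ?x) \<le> 0" by (simp only:)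
  then have "0 \<le> (a - ?x) \<bullet> (y - ?x)" by (simp only: inner_minus_right neg_le_0_iff_le)
  then show ?thesis using closest_point_dot[OF S assms(2), of a] by simp
qed

text \<open>With \<open>d\<close> the circumcentric direction, \<open>-d\<close> is the projection
  of the origin onto the affine hull, so \<open>d\<close> is orthogonal to
  \<open>v + d\<close>.\<close>

lemma inner_circumcentric_direction:
  assumes "v \<in> normalized_conic_base K"
  shows "circumcentric_direction K \<bullet> v = - (norm (circumcentric_direction K))\<^sup>2"
proof -
  let ?A = "affine hull (normalized_conic_base K)"
  have "(0 - closest_point ?A 0) \<bullet> (v - closest_point ?A 0) = 0"
    using assms by (intro closest_point_affine_orthogonal affine_affine_hull hull_inc)
  then show ?thesis
    unfolding circumcentric_direction_def power2_norm_eq_inner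
    by (simp add: inner_diff_right)
qed

text \<open>Since \<open>0 \<le> b\<close>, the point \<open>t = 0\<close> is always feasible, and
  the set is \<open>{0..}\<close> or \<open>{0..b / m}\<close>. The case \<open>b = 0\<close> covers
  a vanishing circumcentric direction.\<close>

lemma Sup_ereal_linear_constraint:
  fixes m b :: real
  assumes "0 \<le> b"
  shows "Sup (ereal ` {t. 0 \<le> t \<and> t * m \<le> b}) = (if m \<le> 0 then \<infinity> else ereal (b / m))"
proof (cases "m \<le> 0")
  case True
  then have "{t. 0 \<le> t \<and> t * m \<le> b} = {0..}"
    using assms by (auto intro: order_trans[OF mult_nonneg_nonpos])
  moreover have "Sup (ereal ` {0..}) = \<infinity>"
  proof (rule SUP_PInfty)
    fix n :: nat
    show "\<exists>t\<in>{0..}. ereal (real n) \<le> ereal t" by (rule bexI[of _ "real n"]) auto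
  qed
  ultimately show ?thesis using True by simp
next
  case False
  then have "{t. 0 \<le> t \<and> t * m \<le> b} = {0..b / m}" by (auto simp: pos_le_divide_eq)
  moreover have "Sup (ereal ` {0..b / m}) = ereal (b / m)"
    using False assms by (intro cSup_eq_maximum) auto
  ultimately show ?thesis using False by simp
qed

section \<open>The formula for \<open>rho\<close> and its minimizers\<close>

theorem corollary3p2:
  fixes K :: "(real ^ 'n) set" and u :: "nat \<Rightarrow> real ^ 'n" and p :: nat and d :: "real ^ 'n"
  assumes "polyhedral_cone K"
    and "p \<ge> 1"
    and "normalized_conic_base K = u ` {1..p}"
    and "d = circumcentric_direction K"
  shows "K = cone_generated (normalized_conic_base K)
    \<and> (\<forall>w. w \<noteq> 0 \<longrightarrow>
          rho K w = (if (MAX i\<in>{1..p}. inner w (u i)) \<le> 0 then \<infinity>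
                     else ereal ((norm d)\<^sup>2 / (MAX i\<in>{1..p}. inner w (u i)))))
    \<and> (INF w\<in>sphere 0 1. rho K w) = ereal ((norm d)\<^sup>2)
    \<and> normalized_conic_base K \<subseteq> {w \<in> sphere 0 1. rho K w = ereal ((norm d)\<^sup>2)}
    \<and> (d \<noteq> 0 \<longrightarrow> {w \<in> sphere 0 1. rho K w = ereal ((norm d)\<^sup>2)} = normalized_conic_base K)"
proof -
  let ?B = "normalized_conic_base K"
  define M where "M w = (MAX i\<in>{1..p}. w \<bullet> u i)" for w
  have u: "u i \<in> ?B" if "i \<in> {1..p}" for i using assms(3) that by blast
  have u1: "norm (u i) = 1" if "i \<in> {1..p}" for i
    using u[OF that] by (simp add: normalized_conic_base_def)
  \<comment> \<open>A nonempty base supplies an extreme ray, and this makes \<open>K\<close>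
    pointed.\<close>
  have "u 1 \<in> ?B" using u assms(2) by simp
  then have "0 extreme_point_of K"
    using extreme_ray_imp_extreme_point_0 unfolding normalized_conic_base_def by blast
  then have gen: "K = cone_generated ?B"
    using pointed_polyhedral_cone_eq_cone_generated assms(1) by blast
  have M_le: "M w \<le> c \<longleftrightarrow> (\<forall>i\<in>{1..p}. w \<bullet> u i \<le> c)" for w c
    unfolding M_def using assms(2) by (subst Max_le_iff) auto
  have M_attained: "\<exists>i\<in>{1..p}. M w = w \<bullet> u i" for w
  proof -
    have "M w \<in> (\<lambda>i. w \<bullet> u i) ` {1..p}"
      unfolding M_def using assms(2) by (intro Max_in) auto
    then show ?thesis by blast
  qed
  have du: "d \<bullet> u i = - (norm d)\<^sup>2" if "i \<in> {1..p}" for i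
    using inner_circumcentric_direction[OF u[OF that]] assms(4) by simp
  have polar: "d + t *\<^sub>R w \<in> polar_cone K \<longleftrightarrow> t * M w \<le> (norm d)\<^sup>2" if "0 \<le> t" for t w
  proof -
    have "d + t *\<^sub>R w \<in> polar_cone K \<longleftrightarrow> (\<forall>v\<in>?B. (d + t *\<^sub>R w) \<bullet> v \<le> 0)"
      by (subst gen) (rule mem_polar_cone_cone_generated_iff)
    also have "\<dots> \<longleftrightarrow> (\<forall>i\<in>{1..p}. t * (w \<bullet> u i) \<le> (norm d)\<^sup>2)"
      unfolding assms(3) by (auto simp: inner_add_left du)
    also have "\<dots> \<longleftrightarrow> t * M w \<le> (norm d)\<^sup>2"
    proof
      assume "\<forall>i\<in>{1..p}. t * (w \<bullet> u i) \<le> (norm d)\<^sup>2"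
      then show "t * M w \<le> (norm d)\<^sup>2" using M_attained[of w] by metis
    next
      assume le: "t * M w \<le> (norm d)\<^sup>2"
      \<comment> \<open>Multiplication by \<open>t \<ge> 0\<close> preserves the order, so the
        maximal index gives the binding constraint.\<close>
      have "\<forall>i\<in>{1..p}. t * (w \<bullet> u i) \<le> t * M w"
        using M_le[of w "M w"] that by (auto intro: mult_left_mono)
      then show "\<forall>i\<in>{1..p}. t * (w \<bullet> u i) \<le> (norm d)\<^sup>2" using le by force
    qed
    finally show ?thesis .
  qed
  have rho: "rho K w = (if M w \<le> 0 then \<infinity> else ereal ((norm d)\<^sup>2 / M w))" for w
  proof -
    have "rho K w = Sup (ereal ` {t. 0 \<le> t \<and> t * M w \<le> (norm d)\<^sup>2})"
      unfolding rho_def assms(4)[symmetric] by (simp add: polar cong: conj_cong)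
    then show ?thesis using Sup_ereal_linear_constraint[of "(norm d)\<^sup>2" "M w"] by simp
  qed
  have M_le_1: "M w \<le> 1" if "norm w = 1" for w
  proof -
    have "w \<bullet> u i \<le> 1" if "i \<in> {1..p}" for i
      using norm_cauchy_schwarz[of w "u i"] u1[OF that] \<open>norm w = 1\<close> by simp
    then show ?thesis using M_le by blast
  qed
  \<comment> \<open>Either \<open>rho K w\<close> is infinite or \<open>0 < M w \<le> 1\<close>, and
    dividing by \<open>M w\<close> cannot decrease the numerator.\<close>
  have lower: "ereal ((norm d)\<^sup>2) \<le> rho K w" if "w \<in> sphere 0 1" for w
    using mult_left_le_one_le[of "(norm d)\<^sup>2" "M w"] M_le_1[of w] that
    by (simp add: rho le_divide_eq mult.commute)
  have min: "v \<in> {w \<in> sphere 0 1. rho K w = ereal ((norm d)\<^sup>2)}" if "v \<in> ?B" for v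
  proof -
    obtain i where i: "i \<in> {1..p}" "v = u i" using \<open>v \<in> ?B\<close> unfolding assms(3) by blast
    have "v \<bullet> u i \<le> M v" using M_le[of v "M v"] i(1) by simp
    moreover have "v \<bullet> u i = 1" using u1[OF i(1)] i(2) by (simp add: norm_eq_1)
    ultimately have "M v = 1" using M_le_1[of v] u1[OF i(1)] i(2) by simp
    then show ?thesis using u1[OF i(1)] i(2) by (simp add: rho)
  qed
  have inf: "(INF w\<in>sphere 0 1. rho K w) = ereal ((norm d)\<^sup>2)"
  proof (rule antisym)
    show "(INF w\<in>sphere 0 1. rho K w) \<le> ereal ((norm d)\<^sup>2)"
      using min[OF \<open>u 1 \<in> ?B\<close>] by (intro INF_lower2[of "u 1"]) auto
    show "ereal ((norm d)\<^sup>2) \<le> (INF w\<in>sphere 0 1. rho K w)"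
      by (intro INF_greatest lower)
  qed
  have only: "w \<in> ?B" if "d \<noteq> 0" "w \<in> sphere 0 1" "rho K w = ereal ((norm d)\<^sup>2)" for w
  proof -
    \<comment> \<open>A finite value of \<open>rho\<close> rules out \<open>M w \<le> 0\<close>.
      Cancelling \<open>(norm d)\<^sup>2\<close> to get \<open>M w = 1\<close> is where
      \<open>d \<noteq> 0\<close> enters.\<close>
    have "0 < M w" "(norm d)\<^sup>2 / M w = (norm d)\<^sup>2"
      using that(3) by (auto simp: rho split: if_splits)
    then have "M w = 1" using that(1) by (simp add: field_simps)
    then obtain i where i: "i \<in> {1..p}" "w \<bullet> u i = 1" using M_attained[of w] by metis
    \<comment> \<open>Two unit vectors with inner product 1 coincide: the right-hand side is
      \<open>1 - 2 + 1\<close>.\<close>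
    have "(norm (w - u i))\<^sup>2 = (norm w)\<^sup>2 - 2 * (w \<bullet> u i) + (norm (u i))\<^sup>2"
      by (simp add: power2_norm_eq_inner inner_diff_left inner_diff_right inner_commute)
    also have "\<dots> = 0" using that(2) i(2) u1[OF i(1)] by simp
    finally have "w = u i" by simp
    then show ?thesis using u[OF i(1)] by simp
  qed
  show ?thesis
  proof (intro conjI)
    show "\<forall>w. w \<noteq> 0 \<longrightarrow>
          rho K w = (if (MAX i\<in>{1..p}. inner w (u i)) \<le> 0 then \<infinity>
                     else ereal ((norm d)\<^sup>2 / (MAX i\<in>{1..p}. inner w (u i))))"
      using rho unfolding M_def by (intro allI impI)
    show "?B \<subseteq> {w \<in> sphere 0 1. rho K w = ereal ((norm d)\<^sup>2)}"
      using min by (rule subsetI)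
    then show "d \<noteq> 0 \<longrightarrow> {w \<in> sphere 0 1. rho K w = ereal ((norm d)\<^sup>2)} = ?B"
      using only by (intro impI antisym subsetI) auto
  qed (fact gen inf)+
qed

end
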